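(* Let $f \in \mathcal{P}^{*}$ and let $\Gamma_n$ denote the logarithmic inverse coefficients of $f$. Then $$|\Gamma_n| \le \frac12,\quad n=1,2,\qquad\text{and}\qquad |\Gamma_3|\le \frac{35}{48}.$$ The inequalities are sharp: for each of the three inequalities there is a function in $\mathcal{P}^{*}$ for which equality holds.
   Context: Let $\mathbb{D}=\{z\in\mathbb{C}:|z|<1\}$. $\mathcal{S}$ is the class of functions $f$ that are analytic and univalent (injective) in $\mathbb{D}$ with expansion $f(z)=z+\sum_{n\ge 2}a_n z^n$. A Schwarz function is an analytic $\omega:\mathbb{D}\to\mathbb{C}$ with $\omega(0)=0$ and $|\omega(z)|<1$ for all $z\in\mathbb{D}$. For $g,h$ analytic in $\mathbb{D}$, $g\prec h$ ($g$ is subordinate to $h$) means that there is a Schwarz function $\omega$ with $g(z)=h(\omega(z))$ for all $z\in\mathbb{D}$. The class $\mathcal{P}^{*}$ is $$\mathcal{P}^{*}=\{f\in\mathcal{S}: f'(z)\prec e^{z}(1+\sin z),\ z\in\mathbb{D}\}.$$ For $f\in\mathcal{S}$, the inverse $f^{-1}$ is analytic in $|w|<1/4$, and the logarithmic inverse coefficients $\Gamma_n$ of $f$ are defined by $\log\frac{f^{-1}(w)}{w}=2\sum_{n=1}^{\infty}\Gamma_n w^n$, $|w|<1/4$ (branch of the logarithm vanishing at $w=0$). Explicitly, $$\Gamma_1=-\tfrac12a_2,\quad \Gamma_2=-\tfrac12a_3+\tfrac34a_2^2,\quad \Gamma_3=-\tfrac12\left(a_4-4a_2a_3+\tfrac{10}{3}a_2^3\right).$$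 *)

theory Defs
  imports "HOL-Complex_Analysis.Complex_Analysis"
begin

definition class_S :: "(complex \<Rightarrow> complex) set" where
  "class_S = {f. f holomorphic_on ball 0 1 \<and> inj_on f (ball 0 1) \<and> f 0 = 0 \<and> deriv f 0 = 1}"

definition schwarz_function :: "(complex \<Rightarrow> complex) \<Rightarrow> bool" where
  "schwarz_function \<omega> \<longleftrightarrow>
     \<omega> holomorphic_on ball 0 1 \<and> \<omega> 0 = 0 \<and> (\<forall>z\<in>ball 0 1. norm (\<omega> z) < 1)"

definition subordinate :: "(complex \<Rightarrow> complex) \<Rightarrow> (complex \<Rightarrow> complex) \<Rightarrow> bool" where
  "subordinate g h \<longleftrightarrow> (\<exists>\<omega>. schwarz_function \<omega> \<and> (\<forall>z\<in>ball 0 1. g z = h (\<omega> z)))"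

definition P_star :: "(complex \<Rightarrow> complex) set" where
  "P_star = {f \<in> class_S. subordinate (deriv f) (\<lambda>z. exp z * (1 + sin z))}"

text \<open>
  The analytic branch of the logarithm of \<open>f\<^sup>-\<^sup>1(w)/w\<close> on the disc of radius 1/4 that vanishes at
  the origin, where \<open>f\<^sup>-\<^sup>1(w)/w\<close> has a removable singularity with value 1. By the Koebe quarter
  theorem this disc lies in the image of the unit disc under any \<open>f\<close> in \<^term>\<open>class_S\<close>,
  so \<^const>\<open>inv_into\<close> really is the inverse function there.
\<close>

definition log_inverse_branch :: "(complex \<Rightarrow> complex) \<Rightarrow> (complex \<Rightarrow> complex) \<Rightarrow> bool" where
  "log_inverse_branch f L \<longleftrightarrow>
     L holomorphic_on ball 0 (1/4) \<and> L 0 = 0 \<and>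
     (\<forall>w \<in> ball 0 (1/4) - {0}. exp (L w) = inv_into (ball 0 1) f w / w)"

text \<open>
  The series starts at index 0, but \<open>L 0 = 0\<close> forces the coefficient of index 0 to vanish.
\<close>

definition log_inverse_coeff :: "(complex \<Rightarrow> complex) \<Rightarrow> nat \<Rightarrow> complex" where
  "log_inverse_coeff f =
     (THE \<Gamma>. \<exists>L. log_inverse_branch f L \<and>
        (\<forall>w \<in> ball 0 (1/4). (\<lambda>n. 2 * \<Gamma> n * w ^ n) sums L w))"

end

theory Submission
  imports Defs
begin

text \<open>
  Write \<open>f' = \<phi> \<circ> \<omega>\<close> with \<open>\<phi>(z) = e\<^sup>z (1 + sin z) = 1 + 2 z + 3/2 z\<^sup>2 + 1/2 z\<^sup>3 + \<dots>\<close> and a Schwarz function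
  \<open>\<omega>(z) = c\<^sub>1 z + c\<^sub>2 z\<^sup>2 + c\<^sub>3 z\<^sup>3 + \<dots>\<close>. Comparing coefficients gives
  \<open>\<Gamma>\<^sub>1 = - c\<^sub>1 / 2\<close>, \<open>\<Gamma>\<^sub>2 = - c\<^sub>2 / 3 + c\<^sub>1\<^sup>2 / 2\<close> and
  \<open>\<Gamma>\<^sub>3 = - (c\<^sub>3 - 23/6 c\<^sub>1 c\<^sub>2 + 35/12 c\<^sub>1\<^sup>3) / 4\<close>. The first two bounds follow from \<open>\<bar>c\<^sub>1\<bar> \<le> 1\<close> and
  \<open>\<bar>c\<^sub>2\<bar> \<le> 1 - \<bar>c\<^sub>1\<bar>\<^sup>2\<close>. For the third, the Schur algorithm (\<open>schwarz_function_fps_coeffs\<close>) expresses \<open>c\<^sub>2\<close> and \<open>c\<^sub>3\<close>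
  by parameters subject only to bounds on their moduli, and a completed square (\<open>cubic_coeff_identity\<close>) eliminates
  their arguments; what remains is an elementary inequality in \<open>\<bar>c\<^sub>1\<bar>\<close> and the modulus of a parameter
  (\<open>cubic_coeff_bound\<close>).

  Two facts of geometric function theory are needed besides. The coefficients are defined by a
  logarithm of \<open>f\<^sup>-\<^sup>1(w) / w\<close> on the disc of radius \<open>1/4\<close>, so the image of \<open>f\<close> must contain that disc. It
  does: \<open>\<bar>1 + sin z\<bar> \<ge> 1 - \<bar>z\<bar>\<close> and the Schwarz lemma yield
  \<open>\<bar>f' z\<bar> \<ge> (1 - r) e\<^sup>-\<^sup>r\<close> for \<open>\<bar>z\<bar> = r\<close>, and integration along the preimage of a ray gives a covering disc
  (\<open>univalent_covering\<close>, \<open>P_star_covering\<close>).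

  All three bounds are attained by the function with \<open>\<omega>(z) = z\<close>, the antiderivative of \<open>\<phi>\<close>. It has to be
  univalent, although its derivative does not have positive real part. But \<open>\<phi>(z) / e\<^sup>z = 1 + sin z\<close>
  does, and \<open>exp\<close> maps the unit disc onto a convex domain (\<open>exp_disc_segment\<close>), so the function is
  close-to-convex (\<open>inj_on_if_Re_deriv_div_exp_pos\<close>).
\<close>

section \<open>The real part of the sine on the unit disc\<close>

lemma sinh_le_mult_cosh:
  fixes y :: real
  assumes "0 \<le> y"
  shows "sinh y \<le> y * cosh y"
proof -
  have "(\<lambda>t::real. t * cosh t - sinh t) 0 \<le> (\<lambda>t. t * cosh t - sinh t) y"
  proof (rule DERIV_nonneg_imp_nondecreasing[OF assms])
    fix t :: real assume "0 \<le> t" "t \<le> y"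
    have "((\<lambda>t. t * cosh t - sinh t) has_real_derivative t * sinh t) (at t)"
      by (auto intro!: derivative_eq_intros)
    moreover have "t * sinh t \<ge> 0" using \<open>0 \<le> t\<close> by simp
    ultimately show "\<exists>d. ((\<lambda>t. t * cosh t - sinh t) has_real_derivative d) (at t) \<and> 0 \<le> d" by blast
  qed
  then show ?thesis by simp
qed

text \<open>
  With \<open>z = x + i y\<close> one has \<open>Re (sin z) = sin x cosh y\<close>, so it suffices that
  \<open>x\<^sup>2 cosh\<^sup>2 y \<le> x\<^sup>2 + y\<^sup>2\<close>, i.e. \<open>x\<^sup>2 sinh\<^sup>2 y \<le> y\<^sup>2\<close>. Squaring \<open>sinh y \<le> y cosh y\<close> gives
  \<open>(1 - y\<^sup>2) sinh\<^sup>2 y \<le> y\<^sup>2\<close>, and \<open>x\<^sup>2 \<le> 1 - y\<^sup>2\<close> in the disc. The bound serves twice: it makes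
  \<open>1 + sin z\<close> have positive real part, hence the extremal function univalent, and it bounds
  \<open>\<bar>f'\<bar>\<close> from below, hence produces the covering disc.
\<close>

lemma Re_sin_ge_neg_norm:
  assumes "norm z \<le> 1"
  shows "Re (sin z) \<ge> - norm z"
proof -
  define x y where "x = Re z" and "y = Im z"
  have n: "(norm z)\<^sup>2 = x\<^sup>2 + y\<^sup>2" by (simp add: x_def y_def cmod_power2)
  have le1: "x\<^sup>2 + y\<^sup>2 \<le> 1" using assms n power_le_one[of "norm z" 2] by simp
  have "sinh \<bar>y\<bar> \<le> \<bar>y\<bar> * cosh \<bar>y\<bar>" by (rule sinh_le_mult_cosh) simp
  then have "(sinh \<bar>y\<bar>)\<^sup>2 \<le> (\<bar>y\<bar> * cosh \<bar>y\<bar>)\<^sup>2" by (intro power_mono) auto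
  then have "(sinh y)\<^sup>2 \<le> y\<^sup>2 * (cosh y)\<^sup>2"
    by (simp add: power_mult_distrib sinh_real_abs cosh_real_abs)
  then have 1: "(1 - y\<^sup>2) * (sinh y)\<^sup>2 \<le> y\<^sup>2" by (simp add: cosh_square_eq algebra_simps)
  have "x\<^sup>2 * (sinh y)\<^sup>2 \<le> (1 - y\<^sup>2) * (sinh y)\<^sup>2"
    using le1 by (intro mult_right_mono) auto
  with 1 have "(x * cosh y)\<^sup>2 \<le> (norm z)\<^sup>2"
    unfolding n power_mult_distrib cosh_square_eq by (simp add: algebra_simps)
  then have "\<bar>x * cosh y\<bar> \<le> norm z"
    by (metis abs_le_square_iff abs_norm_cancel)
  moreover have "\<bar>sin x * cosh y\<bar> \<le> \<bar>x * cosh y\<bar>"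
    by (simp add: abs_mult abs_sin_x_le_abs_x mult_right_mono)
  moreover have "Re (sin z) = sin x * cosh y"
    by (simp add: Re_sin cosh_field_def x_def y_def)
  ultimately show ?thesis by linarith
qed

section \<open>Close-to-convexity with respect to the exponential function\<close>

text \<open>
  On the boundary arc \<open>z = - e\<^bsup>i t\<^esup>\<close> the real part of \<open>e\<^sup>z\<close> is \<open>e\<^bsup>- cos t\<^esup> cos (sin t)\<close>, whose derivative
  \<open>e\<^bsup>- cos t\<^esup> sin (t - sin t)\<close> is nonnegative, so its least value \<open>1/e\<close> is taken at \<open>t = 0\<close>. An interior
  point lies to the right of the boundary point with the same imaginary part.
\<close>

lemma Re_exp_gt:
  assumes "norm z < 1"
  shows "Re (exp z) > exp (- 1)"
proof -
  define x y where "x = Re z" and "y = Im z"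
  have yl: "\<bar>y\<bar> < 1" using assms abs_Im_le_cmod[of z] by (simp add: y_def)
  define a where "a = arcsin \<bar>y\<bar>"
  have a: "0 \<le> a" "a \<le> pi/2" "sin a = \<bar>y\<bar>"
    using yl arcsin_bounded[of "\<bar>y\<bar>"] arcsin_le_arcsin[of 0 "\<bar>y\<bar>"] by (auto simp: a_def)
  have ca: "cos a \<ge> 0" using a by (intro cos_ge_zero) auto
  have "(\<lambda>t::real. exp (- cos t) * cos (sin t)) 0 \<le> (\<lambda>t. exp (- cos t) * cos (sin t)) a"
  proof (rule DERIV_nonneg_imp_nondecreasing[OF a(1)])
    fix t assume t: "0 \<le> t" "t \<le> a"
    have "((\<lambda>t. exp (- cos t) * cos (sin t)) has_real_derivative exp (- cos t) * sin (t - sin t)) (at t)"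
      by (auto intro!: derivative_eq_intros simp: sin_diff algebra_simps)
    moreover have "sin (t - sin t) \<ge> 0"
    proof (rule sin_ge_zero)
      show "0 \<le> t - sin t" using t by (simp add: sin_x_le_x)
      have "sin t \<ge> 0" using t a by (intro sin_ge_zero) auto
      then show "t - sin t \<le> pi" using t a pi_gt_zero by linarith
    qed
    ultimately show "\<exists>d. ((\<lambda>t. exp (- cos t) * cos (sin t)) has_real_derivative d) (at t) \<and> 0 \<le> d"
      by (metis exp_ge_zero mult_nonneg_nonneg)
  qed
  then have 1: "exp (- 1) \<le> exp (- cos a) * cos y"
    using a by simp
  have "x\<^sup>2 + y\<^sup>2 < 1"
    using assms by (simp add: x_def y_def cmod_def)
  moreover have "(cos a)\<^sup>2 = 1 - y\<^sup>2" using a by (simp add: cos_squared_eq)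
  ultimately have "\<bar>x\<bar>\<^sup>2 < (cos a)\<^sup>2" by simp
  then have "\<bar>x\<bar> < cos a" using ca power_less_imp_less_base by blast
  then have "exp (- cos a) < exp x" by simp
  moreover have "cos y > 0" using yl pi_gt3 by (intro cos_gt_zero_pi) auto
  ultimately have "exp (- cos a) * cos y < exp x * cos y" by simp
  with 1 show ?thesis by (simp add: Re_exp x_def y_def)
qed

lemma Ln_exp_disc: "norm z < 1 \<Longrightarrow> Ln (exp z) = z"
  using abs_Im_le_cmod[of z] pi_gt3 by (intro Ln_exp) auto

lemma has_real_derivative_Re:
  "(Z has_vector_derivative z') (at t) \<Longrightarrow> ((\<lambda>t. Re (Z t)) has_real_derivative Re z') (at t)"
  using bounded_linear.has_vector_derivative[OF bounded_linear_Re]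
  by (simp add: has_real_derivative_iff_has_vector_derivative)

lemma Ln_segment_has_vector_derivative:
  assumes "Re (a + of_real t * v) > 0"
  shows "((\<lambda>t. Ln (a + of_real t * v)) has_vector_derivative v / (a + of_real t * v)) (at t)"
proof -
  have "((\<lambda>w. Ln (a + w * v)) has_field_derivative v / (a + of_real t * v)) (at (of_real t))"
    using assms by (auto intro!: derivative_eq_intros simp: complex_nonpos_Reals_iff field_simps)
  from has_vector_derivative_real_field[OF this] show ?thesis .
qed

lemma Re_exp_segment_gt:
  fixes z1 z2 :: complex and t :: real
  assumes "norm z1 < 1" "norm z2 < 1" "0 \<le> t" "t \<le> 1"
  shows "Re (exp z1 + of_real t * (exp z2 - exp z1)) > exp (- 1)"
proof -
  have "convex {w :: complex. exp (- 1) < Re w}" by (rule convex_halfspace_Re_gt)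
  moreover have "exp z1 \<in> {w. exp (- 1) < Re w}" "exp z2 \<in> {w. exp (- 1) < Re w}"
    using Re_exp_gt assms by auto
  ultimately have "(1 - t) *\<^sub>R exp z1 + t *\<^sub>R exp z2 \<in> {w. exp (- 1) < Re w}"
    using assms by (intro convexD) auto
  then show ?thesis by (simp add: algebra_simps)
qed

text \<open>
  The image of the unit disc under \<open>exp\<close> is convex. Let \<open>Z\<close> be the logarithm along a segment joining
  two image points. If \<open>\<bar>Z\<bar>\<close> reached 1, then \<open>\<bar>Z\<bar>\<^sup>2\<close> would have an interior maximum. With \<open>p = Z'\<close> one has \<open>p' = - p\<^sup>2\<close>; at
  the maximum \<open>Re (cnj Z p) = 0\<close>, and then the second derivative of \<open>\<bar>Z\<bar>\<^sup>2 / 2\<close> equals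
  \<open>\<bar>p\<bar>\<^sup>2 (1 + Re Z)\<close>. It is positive because the segment stays in the half plane \<open>Re w > 1/e\<close>,
  where \<open>Re (Ln w) = ln \<bar>w\<bar> > - 1\<close>: a contradiction.
\<close>

lemma exp_disc_segment:
  fixes z1 z2 :: complex and t :: real
  assumes z1: "norm z1 < 1" and z2: "norm z2 < 1" and t: "0 \<le> t" "t \<le> 1"
  defines "v \<equiv> exp z2 - exp z1"
  shows "norm (Ln (exp z1 + of_real t * v)) < 1"
proof (rule ccontr)
  assume neg: "\<not> norm (Ln (exp z1 + of_real t * v)) < 1"
  define w where "w = (\<lambda>t::real. exp z1 + of_real t * v)"
  have w_half: "Re (w t) > exp (- 1)" if "0 \<le> t" "t \<le> 1" for t
    using Re_exp_segment_gt[OF z1 z2 that] by (simp add: w_def v_def)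
  have w_pos: "Re (w t) > 0" if "0 \<le> t" "t \<le> 1" for t
    using w_half[OF that] exp_gt_zero[of "-1::real"] by linarith
  define Z where "Z = (\<lambda>t. Ln (w t))"
  define p where "p = (\<lambda>t. v / w t)"
  have dZ: "(Z has_vector_derivative p t) (at t)" if "0 \<le> t" "t \<le> 1" for t
    using Ln_segment_has_vector_derivative w_pos[OF that] unfolding Z_def p_def w_def by blast
  have dp: "(p has_vector_derivative - (p t)\<^sup>2) (at t)" if "0 \<le> t" "t \<le> 1" for t
  proof -
    have "w t \<noteq> 0" using w_pos[OF that] by auto
    then have "((\<lambda>s. v / (exp z1 + s * v)) has_field_derivative - (p t)\<^sup>2) (at (of_real t))"
      unfolding p_def w_def
      by (auto intro!: derivative_eq_intros simp: power2_eq_square)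
    from has_vector_derivative_real_field[OF this] show ?thesis by (simp add: p_def w_def)
  qed
  \<comment> \<open>Half the derivative of \<open>N = \<bar>Z\<bar>\<^sup>2\<close> is \<open>D = Re (cnj Z p)\<close>.\<close>
  define N where "N = (\<lambda>t. (Re (Z t))\<^sup>2 + (Im (Z t))\<^sup>2)"
  define D where "D = (\<lambda>t. Re (Z t) * Re (p t) + Im (Z t) * Im (p t))"
  have dN: "(N has_real_derivative 2 * D t) (at t)" if "0 \<le> t" "t \<le> 1" for t
    using dZ[OF that]
    unfolding N_def D_def by (auto intro!: derivative_eq_intros simp: algebra_simps)
  have dD: "(D has_real_derivative (norm (p t))\<^sup>2 - Re (cnj (Z t) * (p t)\<^sup>2)) (at t)"
    if "0 \<le> t" "t \<le> 1" for t
    using dZ[OF that] dp[OF that] unfolding D_def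
    by (auto intro!: derivative_eq_intros simp: algebra_simps cmod_power2)
      (simp add: power2_eq_square)
  have "continuous_on {0..1} N"
    using dN by (meson DERIV_isCont atLeastAtMost_iff continuous_at_imp_continuous_on)
  then obtain s where s: "s \<in> {0..1}" and max: "\<And>u. u \<in> {0..1} \<Longrightarrow> N u \<le> N s"
    using continuous_attains_sup[of "{0..1::real}" N] by (auto simp: compact_Icc)
  have N_norm: "N u = (norm (Z u))\<^sup>2" for u by (simp add: N_def cmod_power2)
  have "norm (Z t) \<ge> 1" using neg by (simp add: Z_def w_def)
  then have "N t \<ge> 1" by (simp add: N_norm)
  then have Ns: "N s \<ge> 1" using max[of t] t by auto
  have Z0: "Z 0 = z1" and Z1: "Z 1 = z2"
    using Ln_exp_disc z1 z2 by (auto simp: Z_def w_def v_def)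
  have "N 0 < 1" "N 1 < 1"
    using z1 z2 by (auto simp: N_norm Z0 Z1 power_less_one_iff)
  then have s01: "0 < s" "s < 1" using Ns s by (auto simp: less_le)
  have sle: "0 \<le> s" "s \<le> 1" using s01 by auto
  have "2 * D s = 0"
  proof (rule DERIV_local_max[OF dN[OF sle], of "min s (1 - s)"])
    show "0 < min s (1 - s)" using s01 by simp
    show "\<forall>y. \<bar>s - y\<bar> < min s (1 - s) \<longrightarrow> N y \<le> N s"
    proof (intro allI impI)
      fix y assume "\<bar>s - y\<bar> < min s (1 - s)"
      then have "y \<in> {0..1}" by (auto simp: abs_less_iff)
      then show "N y \<le> N s" by (rule max)
    qed
  qed
  then have Ds: "D s = 0" by simp
  have v0: "v \<noteq> 0"
  proof
    assume "v = 0"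
    then have "Z t = Z 0" by (simp add: Z_def w_def)
    then show False using \<open>N t \<ge> 1\<close> \<open>N 0 < 1\<close> by (simp add: N_def)
  qed
  have ws: "w s \<noteq> 0" using w_pos[OF sle] by auto
  then have ps: "p s \<noteq> 0" using v0 by (simp add: p_def)
  have "Re (Z s) = ln (norm (w s))" using ws by (simp add: Z_def Re_Ln)
  moreover have "norm (w s) > exp (- 1)"
    using w_half[OF sle] complex_Re_le_cmod[of "w s"] by linarith
  then have "ln (norm (w s)) > -1"
    using ln_less_cancel_iff[of "exp (-1)" "norm (w s)"] ws by simp
  ultimately have ReZ: "Re (Z s) > -1" by simp
  have "(norm (Z s))\<^sup>2 * Re (cnj (Z s) * (p s)\<^sup>2) = - (norm (Z s))\<^sup>2 * (norm (p s))\<^sup>2 * Re (Z s)"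
  proof -
    define a b c d where "a = Re (Z s)" and "b = Im (Z s)" and "c = Re (p s)" and "d = Im (p s)"
    have e: "a * c + b * d = 0" using Ds by (simp add: D_def a_def b_def c_def d_def)
    have "(a\<^sup>2 + b\<^sup>2) * (a * (c\<^sup>2 - d\<^sup>2) + 2 * b * c * d) = - (a\<^sup>2 + b\<^sup>2) * (c\<^sup>2 + d\<^sup>2) * a"
      using e by algebra
    moreover have "Re (cnj (Z s) * (p s)\<^sup>2) = a * (c\<^sup>2 - d\<^sup>2) + 2 * b * c * d"
      by (simp add: a_def b_def c_def d_def power2_eq_square algebra_simps)
    moreover have "(norm (Z s))\<^sup>2 = a\<^sup>2 + b\<^sup>2" "(norm (p s))\<^sup>2 = c\<^sup>2 + d\<^sup>2"
      by (simp_all add: cmod_power2 a_def b_def c_def d_def)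
    ultimately show ?thesis by (simp add: a_def)
  qed
  moreover have "(norm (Z s))\<^sup>2 \<noteq> 0" using Ns unfolding N_norm by linarith
  ultimately have "Re (cnj (Z s) * (p s)\<^sup>2) = - (norm (p s))\<^sup>2 * Re (Z s)"
    by (metis (no_types, lifting) mult.assoc mult_cancel_left mult_minus_left mult_minus_right)
  then have "(norm (p s))\<^sup>2 - Re (cnj (Z s) * (p s)\<^sup>2) = (norm (p s))\<^sup>2 * (1 + Re (Z s))"
    by (simp add: algebra_simps)
  also have "\<dots> > 0" using ps ReZ by simp
  finally obtain \<delta> where \<delta>: "\<delta> > 0" "\<And>h. 0 < h \<Longrightarrow> h < \<delta> \<Longrightarrow> D s < D (s + h)"
    using DERIV_pos_inc_right[OF dD[OF sle]] by blast
  \<comment> \<open>\<open>D\<close> vanishes at \<open>s\<close> and increases through it, so \<open>N\<close> exceeds its maximum just to the right of \<open>s\<close>.\<close>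
  define h where "h = min (\<delta>/2) (1 - s)"
  have h: "0 < h" "h < \<delta>" "s + h \<le> 1" using \<delta>(1) s01 by (auto simp: h_def)
  have "\<exists>\<xi>. s < \<xi> \<and> \<xi> < s + h \<and> N (s + h) - N s = (s + h - s) * (2 * D \<xi>)"
    using h s01 by (intro MVT2) (auto intro!: dN)
  then obtain \<xi> where \<xi>: "s < \<xi>" "\<xi> < s + h" "N (s + h) - N s = h * (2 * D \<xi>)" by auto
  have "D \<xi> > 0" using \<delta>(2)[of "\<xi> - s"] \<xi> h Ds by auto
  then have "N (s + h) > N s" using \<xi>(3) h by (smt (verit) mult_pos_pos)
  then show False using max[of "s + h"] h s01 by auto
qed

text \<open>
  This is close-to-convexity with respect to the convex function \<open>exp\<close>, with the Noshiro-Warschawski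
  argument. Pull the segment from \<open>exp z1\<close> to \<open>exp z2\<close>, of direction \<open>v\<close>, back by the logarithm; by
  convexity the pulled-back path stays in the disc. Along it \<open>f / v\<close> has derivative \<open>f' / exp\<close>, of
  positive real part, so the values of \<open>f\<close> at the two ends differ.
\<close>

lemma inj_on_if_Re_deriv_div_exp_pos:
  assumes holf: "f holomorphic_on ball 0 1"
    and pos: "\<And>z. norm z < 1 \<Longrightarrow> Re (deriv f z / exp z) > 0"
  shows "inj_on f (ball 0 1)"
proof (rule inj_onI)
  fix z1 z2 :: complex assume "z1 \<in> ball 0 1" "z2 \<in> ball 0 1" and eq: "f z1 = f z2"
  then have z: "norm z1 < 1" "norm z2 < 1" by auto
  define v where "v = exp z2 - exp z1"
  show "z1 = z2"
  proof (cases "v = 0")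
    case True
    then show ?thesis using Ln_exp_disc z by (metis v_def eq_iff_diff_eq_0)
  next
    case False
    define w where "w = (\<lambda>t::real. exp z1 + of_real t * v)"
    define Z where "Z = (\<lambda>t. Ln (w t))"
    have w_pos: "Re (w t) > 0" if "0 \<le> t" "t \<le> 1" for t
      using Re_exp_segment_gt[OF z that] exp_gt_zero[of "-1::real"] unfolding w_def v_def by linarith
    define G where "G = (\<lambda>t. Re (f (Z t) / v))"
    have dG: "(G has_real_derivative Re (deriv f (Z t) / exp (Z t))) (at t)" if "0 \<le> t" "t \<le> 1" for t
    proof -
      have n: "norm (Z t) < 1"
        using exp_disc_segment[OF z that] by (simp add: Z_def w_def v_def)
      have w0: "w t \<noteq> 0" using w_pos[OF that] by auto
      have "(f has_field_derivative deriv f (Z t)) (at (Z t))"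
        using holf n by (intro holomorphic_derivI[of _ "ball 0 1"]) auto
      moreover have "(Z has_vector_derivative v / w t) (at t)"
        using Ln_segment_has_vector_derivative w_pos[OF that] unfolding Z_def w_def by blast
      ultimately have "((f \<circ> Z) has_vector_derivative v / w t * deriv f (Z t)) (at t)"
        by (intro field_vector_diff_chain_at)
      from has_vector_derivative_divide[OF this, of v]
      have "((\<lambda>t. f (Z t) / v) has_vector_derivative v / w t * deriv f (Z t) / v) (at t)"
        by (simp add: o_def)
      moreover have "v / w t * deriv f (Z t) / v = deriv f (Z t) / exp (Z t)"
        using False w0 by (simp add: Z_def)
      ultimately show ?thesis unfolding G_def by (metis has_real_derivative_Re)
    qed
    have "\<exists>\<xi>. 0 < \<xi> \<and> \<xi> < 1 \<and> G 1 - G 0 = (1 - 0) * Re (deriv f (Z \<xi>) / exp (Z \<xi>))"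
      by (intro MVT2 dG) auto
    then obtain \<xi> where \<xi>: "0 < \<xi>" "\<xi> < 1" "G 1 - G 0 = Re (deriv f (Z \<xi>) / exp (Z \<xi>))"
      by auto
    have "norm (Z \<xi>) < 1"
      using exp_disc_segment[OF z, of \<xi>] \<xi> by (simp add: Z_def w_def v_def)
    then have "G 1 > G 0" using pos[of "Z \<xi>"] \<xi> by simp
    moreover have "Z 0 = z1" "Z 1 = z2"
      using Ln_exp_disc z by (auto simp: Z_def w_def v_def)
    ultimately show ?thesis using eq by (simp add: G_def)
  qed
qed

section \<open>Covering discs and the branch of the logarithm\<close>

text \<open>
  The growth bound for univalent functions: a radial lower bound for \<open>\<bar>f'\<bar>\<close> integrates to a lower
  bound for \<open>\<bar>f\<bar>\<close>. Let \<open>m\<close> be the minimum of \<open>\<bar>f\<bar>\<close> on the circle of radius \<open>R\<close>, taken at \<open>z1\<close>. The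
  image of \<open>ball 0 R\<close> is open and its frontier keeps distance at least \<open>m\<close> from the origin, so the image contains
  \<open>ball 0 m\<close>. Hence the ray from \<open>0\<close> to \<open>f z1\<close> lifts through \<open>f\<close> to a path \<open>\<gamma>\<close> from \<open>0\<close> to \<open>z1\<close>,
  with \<open>\<bar>\<gamma>'\<bar> = m / \<bar>f' \<gamma>\<bar>\<close>, so \<open>\<psi> \<bar>\<gamma>\<bar>\<close> grows at a rate of at most \<open>m\<close> and \<open>\<psi> R \<le> m\<close>.
\<close>

lemma univalent_covering:
  fixes \<psi> \<psi>' :: "real \<Rightarrow> real"
  assumes holf: "f holomorphic_on ball 0 1" and inj: "inj_on f (ball 0 1)" and f0: "f 0 = 0"
    and psi0: "\<psi> 0 = 0"
    and dpsi: "\<And>r. (\<psi> has_real_derivative \<psi>' r) (at r)"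
    and psi'_nonneg: "\<And>r. 0 \<le> r \<Longrightarrow> r < 1 \<Longrightarrow> 0 \<le> \<psi>' r"
    and psi'_le: "\<And>z. norm z < 1 \<Longrightarrow> \<psi>' (norm z) \<le> norm (deriv f z)"
    and R: "0 < R" "R < 1"
  shows "ball 0 (\<psi> R) \<subseteq> f ` ball 0 1"
proof -
  have contf: "continuous_on (ball 0 1) f" by (rule holomorphic_on_imp_continuous_on[OF holf])
  have sph: "sphere 0 R \<subseteq> ball 0 1" and cb: "cball 0 R \<subseteq> ball 0 1" and bb: "ball 0 R \<subseteq> ball 0 1"
    using R by auto
  have "continuous_on (sphere 0 R) (\<lambda>z. norm (f z))"
    by (intro continuous_on_norm continuous_on_subset[OF contf sph])
  moreover have "sphere (0::complex) R \<noteq> {}" using R by simp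
  ultimately obtain z1 where z1: "norm z1 = R" and min: "\<And>z. norm z = R \<Longrightarrow> norm (f z1) \<le> norm (f z)"
    using continuous_attains_inf[of "sphere 0 R" "\<lambda>z. norm (f z)"] by auto
  define w1 where "w1 = f z1"
  define m where "m = norm w1"
  have z1D: "z1 \<in> ball 0 1" using z1 R by simp
  have w1_nz: "w1 \<noteq> 0"
  proof
    assume "w1 = 0"
    then have "f z1 = f 0" by (simp add: w1_def f0)
    then have "z1 = 0" using inj z1D by (auto simp: inj_on_def)
    then show False using z1 R by simp
  qed
  then have m: "m > 0" by (simp add: m_def)
  have sub: "ball 0 m \<subseteq> f ` ball 0 R"
  proof (rule ccontr)
    assume "\<not> ball 0 m \<subseteq> f ` ball 0 R"
    moreover have "0 \<in> f ` ball 0 R"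
      using R f0 by (auto intro!: image_eqI[of _ _ 0])
    then have "ball 0 m \<inter> f ` ball 0 R \<noteq> {}" using m by force
    ultimately have "ball 0 m \<inter> frontier (f ` ball 0 R) \<noteq> {}"
      by (intro connected_Int_frontier) auto
    then obtain y where y: "norm y < m" "y \<in> frontier (f ` ball 0 R)" by auto
    have "open (f ` ball 0 R)"
      using holf inj bb by (intro open_mapping_thm3) (auto intro: holomorphic_on_subset inj_on_subset)
    then have "y \<notin> f ` ball 0 R" using y by (simp add: frontier_def interior_open)
    moreover have "y \<in> f ` cball 0 R"
    proof -
      have "compact (f ` cball 0 R)"
        by (intro compact_continuous_image continuous_on_subset[OF contf cb]) simp
      then have "closure (f ` ball 0 R) \<subseteq> f ` cball 0 R"
        by (intro closure_minimal) (auto simp: compact_imp_closed)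
      then show ?thesis using y by (auto simp: frontier_def)
    qed
    ultimately obtain z where "y = f z" "norm z = R" by force
    then show False using min[of z] y by (simp add: m_def w1_def)
  qed
  obtain g where holg: "g holomorphic_on f ` ball 0 1"
    and dg: "\<And>z. z \<in> ball 0 1 \<Longrightarrow> deriv f z * deriv g (f z) = 1"
    and gf: "\<And>z. z \<in> ball 0 1 \<Longrightarrow> g (f z) = z"
    using holomorphic_has_inverse[OF holf open_ball inj] by metis
  have open_im: "open (f ` ball 0 1)" by (rule open_mapping_thm3[OF holf open_ball inj])
  define \<gamma> where "\<gamma> = (\<lambda>t::real. g (of_real t * w1))"
  have ray: "\<exists>z. norm z < 1 \<and> f z = of_real t * w1" if t: "0 \<le> t" "t \<le> 1" for t
  proof (cases "t = 1")
    case True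
    then show ?thesis using z1D by (auto simp: w1_def)
  next
    case False
    then have "norm (of_real t * w1) < m" using t m by (simp add: norm_mult m_def)
    then have "of_real t * w1 \<in> f ` ball 0 R" using sub by auto
    then obtain z where "norm z < R" "of_real t * w1 = f z" by auto
    then show ?thesis using R by (intro exI[of _ z]) auto
  qed
  have d\<gamma>: "(\<gamma> has_vector_derivative w1 / deriv f (\<gamma> t)) (at t)"
    and norm_\<gamma>: "norm (\<gamma> t) < 1" and f_\<gamma>: "f (\<gamma> t) = of_real t * w1"
    and df_nz: "deriv f (\<gamma> t) \<noteq> 0" if t: "0 \<le> t" "t \<le> 1" for t
  proof -
    obtain z where z: "norm z < 1" "f z = of_real t * w1" using ray[OF t] by blast
    have gz: "\<gamma> t = z" using gf[of z] z by (simp add: \<gamma>_def)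
    have eq: "deriv f z * deriv g (f z) = 1" using dg[of z] z by simp
    then show "deriv f (\<gamma> t) \<noteq> 0" by (auto simp: gz)
    then have dgv: "deriv g (of_real t * w1) = 1 / deriv f z"
      using eq z by (simp add: gz field_simps)
    have "(g has_field_derivative deriv g (of_real t * w1)) (at (of_real t * w1))"
      using z by (intro holomorphic_derivI[OF holg open_im]) (auto simp flip: z(2))
    then have "((\<lambda>s. g (s * w1)) has_field_derivative deriv g (of_real t * w1) * w1) (at (of_real t))"
      by (rule DERIV_chain2) (auto intro!: derivative_eq_intros)
    from has_vector_derivative_real_field[OF this]
    show "(\<gamma> has_vector_derivative w1 / deriv f (\<gamma> t)) (at t)" by (simp add: \<gamma>_def dgv gz[unfolded \<gamma>_def])
    show "norm (\<gamma> t) < 1" "f (\<gamma> t) = of_real t * w1" using z gz by auto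
  qed
  define \<Psi> where "\<Psi> = (\<lambda>t. \<psi> (norm (\<gamma> t)))"
  have cont\<gamma>: "continuous_on {0..1} \<gamma>"
    using d\<gamma> by (meson atLeastAtMost_iff continuous_at_imp_continuous_on has_vector_derivative_continuous)
  have "continuous_on UNIV \<psi>"
    using dpsi by (meson DERIV_isCont continuous_at_imp_continuous_on)
  then have cont\<Psi>: "continuous_on {0..1} \<Psi>"
    unfolding \<Psi>_def by (rule continuous_on_compose2) (auto intro!: continuous_on_norm cont\<gamma>)
  have d\<Psi>: "\<exists>l. (\<Psi> has_real_derivative l) (at t) \<and> l \<le> m" if t: "0 < t" "t < 1" for t
  proof -
    have t': "0 \<le> t" "t \<le> 1" using t by auto
    have nz: "\<gamma> t \<noteq> 0" using f_\<gamma>[OF t'] t w1_nz f0 by auto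
    define \<gamma>' where "\<gamma>' = w1 / deriv f (\<gamma> t)"
    have "((\<lambda>t. norm (\<gamma> t)) has_derivative (\<lambda>h. (h *\<^sub>R \<gamma>') \<bullet> sgn (\<gamma> t))) (at t)"
      using has_derivative_compose[OF d\<gamma>[OF t', unfolded has_vector_derivative_def] has_derivative_norm[OF nz]]
      by (simp add: \<gamma>'_def)
    then have "((\<lambda>t. norm (\<gamma> t)) has_real_derivative \<gamma>' \<bullet> sgn (\<gamma> t)) (at t)"
      unfolding has_field_derivative_def by (simp add: mult.commute[of _ "\<gamma>' \<bullet> sgn (\<gamma> t)"])
    from DERIV_chain2[OF dpsi this]
    have "(\<Psi> has_real_derivative \<psi>' (norm (\<gamma> t)) * (\<gamma>' \<bullet> sgn (\<gamma> t))) (at t)"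
      by (simp add: \<Psi>_def)
    moreover have "\<psi>' (norm (\<gamma> t)) * (\<gamma>' \<bullet> sgn (\<gamma> t)) \<le> m"
    proof -
      have "\<gamma>' \<bullet> sgn (\<gamma> t) \<le> norm \<gamma>'"
        using norm_cauchy_schwarz[of \<gamma>' "sgn (\<gamma> t)"] nz by (simp add: norm_sgn)
      then have "\<psi>' (norm (\<gamma> t)) * (\<gamma>' \<bullet> sgn (\<gamma> t)) \<le> \<psi>' (norm (\<gamma> t)) * norm \<gamma>'"
        using psi'_nonneg norm_\<gamma>[OF t'] by (intro mult_left_mono) auto
      also have "\<dots> \<le> norm (deriv f (\<gamma> t)) * norm \<gamma>'"
        using psi'_le norm_\<gamma>[OF t'] by (intro mult_right_mono) auto
      also have "\<dots> = m" using df_nz[OF t'] by (simp add: \<gamma>'_def m_def norm_divide)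
      finally show ?thesis .
    qed
    ultimately show ?thesis by blast
  qed
  have "\<exists>l s. 0 < s \<and> s < 1 \<and> (\<Psi> has_real_derivative l) (at s) \<and> \<Psi> 1 - \<Psi> 0 = (1 - 0) * l"
    using d\<Psi> by (intro MVT cont\<Psi>) (auto simp: real_differentiable_def)
  then obtain l s where l: "0 < s" "s < 1" "(\<Psi> has_real_derivative l) (at s)" "\<Psi> 1 - \<Psi> 0 = l" by auto
  then have "l \<le> m" using d\<Psi>[OF l(1,2)] DERIV_unique by blast
  moreover have "\<gamma> 0 = 0" using gf[of 0] f0 by (simp add: \<gamma>_def)
  moreover have "\<gamma> 1 = z1" using gf[OF z1D] by (simp add: \<gamma>_def w1_def)
  ultimately have "\<psi> R \<le> m" using l(4) by (simp add: \<Psi>_def z1 psi0)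
  then have "ball 0 (\<psi> R) \<subseteq> ball (0 :: complex) m" by (rule subset_ball)
  then show ?thesis using sub image_mono[OF bb, of f] by (meson order_trans)
qed

text \<open>
  After filling in the value 1 at the origin, \<open>f\<^sup>-\<^sup>1(w) / w\<close> is holomorphic and without zeros on a disc,
  so it has a logarithm there; subtracting the value at \<open>0\<close>, a period of \<open>exp\<close>, normalises it.
\<close>

lemma log_inverse_branch_exists:
  assumes f: "f \<in> class_S" and cov: "ball 0 (1/4) \<subseteq> f ` ball 0 1"
  obtains L where "log_inverse_branch f L"
proof -
  have holf: "f holomorphic_on ball 0 1" and inj: "inj_on f (ball 0 1)" and f0: "f 0 = 0"
    and df0: "deriv f 0 = 1" using f by (auto simp: class_S_def)
  obtain g where holg: "g holomorphic_on f ` ball 0 1"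
    and dg: "\<And>z. z \<in> ball 0 1 \<Longrightarrow> deriv f z * deriv g (f z) = 1"
    and gf: "\<And>z. z \<in> ball 0 1 \<Longrightarrow> g (f z) = z"
    using holomorphic_has_inverse[OF holf open_ball inj] by metis
  have g_inv: "g w = inv_into (ball 0 1) f w" if "w \<in> ball 0 (1/4)" for w
    using that cov gf inj by (metis f_inv_into_f inv_into_into subsetD)
  have g0: "g 0 = 0" using gf[of 0] f0 by simp
  have dg0: "deriv g 0 = 1" using dg[of 0] f0 df0 by simp
  define h where "h = (\<lambda>w. if w = 0 then 1 else g w / w)"
  have "h holomorphic_on ball 0 (1/4)"
    by (rule pole_theorem_open_0[of g _ 0])
      (auto simp: h_def g0 dg0 intro: holomorphic_on_subset[OF holg cov])
  moreover have "h w \<noteq> 0" if "w \<in> ball 0 (1/4)" for w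
  proof (cases "w = 0")
    case False
    obtain z where z: "z \<in> ball 0 1" "w = f z" using cov \<open>w \<in> ball 0 (1/4)\<close> by blast
    then have "g w = z" using gf by simp
    moreover have "z \<noteq> 0" using False z f0 by auto
    ultimately show ?thesis using False by (simp add: h_def)
  qed (simp add: h_def)
  ultimately obtain L where L: "L holomorphic_on ball 0 (1/4)" "\<And>w. w \<in> ball 0 (1/4) \<Longrightarrow> h w = exp (L w)"
    using simply_connected_imp_holomorphic_log[of h "ball 0 (1/4)"]
    by (metis convex_ball convex_imp_simply_connected convex_imp_locally_path_connected)
  have "exp (L 0) = 1" using L(2)[of 0] by (simp add: h_def)
  moreover have "exp (L w) = inv_into (ball 0 1) f w / w" if "w \<in> ball 0 (1/4) - {0}" for w
    using L(2)[of w] g_inv[of w] that by (simp add: h_def)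
  ultimately have "log_inverse_branch f (\<lambda>w. L w - L 0)"
    using L(1) by (simp add: log_inverse_branch_def exp_diff holomorphic_intros)
  then show ?thesis using that by blast
qed

text \<open>
  The difference \<open>h\<close> of two branches satisfies \<open>exp h = 1\<close>, so \<open>h'\<close> vanishes.
\<close>

lemma log_inverse_branch_unique:
  assumes "log_inverse_branch f L1" "log_inverse_branch f L2" "w \<in> ball 0 (1/4)"
  shows "L1 w = L2 w"
proof -
  define h where "h = (\<lambda>w. L1 w - L2 w)"
  have holh: "h holomorphic_on ball 0 (1/4)" and h0: "h 0 = 0"
    using assms by (auto simp: h_def log_inverse_branch_def intro!: holomorphic_intros)
  have exp_h: "exp (h w) = 1" if "w \<in> ball 0 (1/4)" for w
  proof (cases "w = 0")
    case False
    then have "exp (L1 w) = exp (L2 w)" using assms that by (simp add: log_inverse_branch_def)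
    then show ?thesis by (simp add: h_def exp_diff)
  qed (simp add: h0)
  have "(h has_field_derivative 0) (at w)" if w: "w \<in> ball 0 (1/4)" for w
  proof -
    have dh: "(h has_field_derivative deriv h w) (at w)"
      using holh w by (intro holomorphic_derivI) auto
    then have "((\<lambda>w. exp (h w)) has_field_derivative exp (h w) * deriv h w) (at w)"
      by (auto intro!: derivative_eq_intros)
    moreover have "((\<lambda>w. exp (h w)) has_field_derivative 0) (at w)"
      by (rule has_field_derivative_transform_within_open[of "\<lambda>_. 1" _ _ "ball 0 (1/4)"])
        (use w exp_h in auto)
    ultimately have "exp (h w) * deriv h w = 0" using DERIV_unique by blast
    then show ?thesis using dh by simp
  qed
  then have "h constant_on ball 0 (1/4)"
    unfolding constant_on_def
    by (intro has_field_derivative_zero_constant convex_ball) (rule has_field_derivative_at_within)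
  then have "h w = h 0" using assms(3) by (auto simp: constant_on_def)
  then show ?thesis unfolding h0 by (simp add: h_def)
qed

lemma log_inverse_coeff_eq:
  assumes L: "log_inverse_branch f L" and G: "L has_fps_expansion G"
  shows "log_inverse_coeff f n = fps_nth G n / 2"
proof -
  have holL: "L holomorphic_on ball 0 (1/4)" using L by (simp add: log_inverse_branch_def)
  have "log_inverse_coeff f = (\<lambda>n. fps_nth G n / 2)"
    unfolding log_inverse_coeff_def
  proof (rule the_equality)
    have "(\<lambda>n. 2 * (fps_nth G n / 2) * w ^ n) sums L w" if "w \<in> ball 0 (1/4)" for w
      using has_fps_expansion_imp_sums_complex[OF G, of "ereal (1/4)" w] holL that
      unfolding eball_ereal less_ereal.simps(1) by simp
    then show "\<exists>L. log_inverse_branch f L \<and>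
        (\<forall>w\<in>ball 0 (1/4). (\<lambda>n. 2 * (fps_nth G n / 2) * w ^ n) sums L w)"
      using L by blast
  next
    fix \<Gamma> assume "\<exists>L. log_inverse_branch f L \<and>
        (\<forall>w\<in>ball 0 (1/4). (\<lambda>n. 2 * \<Gamma> n * w ^ n) sums L w)"
    then obtain L' where L': "log_inverse_branch f L'"
      and s: "\<And>w. w \<in> ball 0 (1/4) \<Longrightarrow> (\<lambda>n. 2 * \<Gamma> n * w ^ n) sums L' w" by blast
    have s': "(\<lambda>n. fps_nth (Abs_fps (\<lambda>n. 2 * \<Gamma> n)) n * w ^ n) sums L w" if "w \<in> ball 0 (1/4)" for w
      using s[OF that] log_inverse_branch_unique[OF L' L that] by simp
    have "L has_fps_expansion Abs_fps (\<lambda>n. 2 * \<Gamma> n)"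
      by (intro has_fps_expansionI eventually_mono[OF eventually_nhds_in_open[of "ball 0 (1/4)"]] s') auto
    then have "Abs_fps (\<lambda>n. 2 * \<Gamma> n) = G"
      using G fps_expansion_unique_complex by blast
    then have "2 * \<Gamma> n = fps_nth G n" for n by (metis fps_nth_Abs_fps)
    then show "\<Gamma> = (\<lambda>n. fps_nth G n / 2)" by (auto simp: fun_eq_iff field_simps)
  qed
  then show ?thesis by simp
qed

section \<open>Logarithmic inverse coefficients from Taylor coefficients\<close>

lemma has_fps_expansion_eventually_eq:
  fixes f g :: "complex \<Rightarrow> complex"
  assumes F: "f has_fps_expansion F" and G: "g has_fps_expansion G"
    and ev: "eventually (\<lambda>z. f z = g z) (nhds 0)"
  shows "F = G"
proof -
  have "f has_fps_expansion G" using G has_fps_expansion_cong[OF ev refl, of G] by simp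
  with F show ?thesis by (rule fps_expansion_unique_complex)
qed

text \<open>
  Substituting \<open>w = f z\<close> into \<open>exp (L w) = f\<^sup>-\<^sup>1(w) / w\<close> gives \<open>exp (L (f z)) f z = z\<close>. Differentiating
  and eliminating the exponential with the help of the equation itself leaves a relation between the
  expansions of \<open>f\<close> and \<open>L\<close> that is free of inverses and exponentials, so coefficients can be compared.
\<close>

lemma log_inverse_fps_eq:
  assumes f: "f \<in> class_S" and F: "f has_fps_expansion F"
    and L: "log_inverse_branch f L" and G: "L has_fps_expansion G"
  shows "fps_X * fps_deriv F * (1 + (fps_deriv G oo F) * F) = F"
proof -
  have holf: "f holomorphic_on ball 0 1" and inj: "inj_on f (ball 0 1)" and f0: "f 0 = 0"
    using f by (auto simp: class_S_def)
  have F0: "fps_nth F 0 = 0" using has_fps_expansion_imp_0_eq_fps_nth_0[OF F] f0 by simp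
  have G0: "fps_nth G 0 = 0"
    using has_fps_expansion_imp_0_eq_fps_nth_0[OF G] L by (simp add: log_inverse_branch_def)
  define E where "E = fps_exp (1::complex) oo (G oo F)"
  have eE: "(exp \<circ> (L \<circ> f)) has_fps_expansion E"
    unfolding E_def
    by (intro has_fps_expansion_compose G F F0 has_fps_expansion_exp1) (simp add: G0)
  then have 1: "(\<lambda>z. (exp \<circ> (L \<circ> f)) z * f z) has_fps_expansion E * F"
    using F by (rule has_fps_expansion_mult)
  have "f \<midarrow>0\<rightarrow> f 0"
    using holf by (metis centre_in_ball continuous_on_eq_continuous_at holomorphic_on_imp_continuous_on
        isCont_def open_ball zero_less_one)
  then have "(f \<longlongrightarrow> 0) (nhds 0)" by (simp add: tendsto_nhds_iff f0)
  then have "eventually (\<lambda>z. f z \<in> ball 0 (1/4)) (nhds 0)"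
    by (rule topological_tendstoD) auto
  moreover have "eventually (\<lambda>z::complex. z \<in> ball 0 1) (nhds 0)"
    by (intro eventually_nhds_in_open) auto
  ultimately have "eventually (\<lambda>z. (exp \<circ> (L \<circ> f)) z * f z = z) (nhds 0)"
  proof eventually_elim
    case (elim z)
    show ?case
    proof (cases "z = 0")
      case False
      then have "f z \<noteq> 0" using inj elim(2) f0 by (metis centre_in_ball inj_onD zero_less_one)
      then have "exp (L (f z)) = inv_into (ball 0 1) f (f z) / f z"
        using L elim(1) by (simp add: log_inverse_branch_def)
      then show ?thesis using \<open>f z \<noteq> 0\<close> inj elim(2) by simp
    qed (simp add: f0)
  qed
  then have EF: "E * F = fps_X"
    by (rule has_fps_expansion_eventually_eq[OF 1 has_fps_expansion_fps_X])
  have "fps_deriv E = E * fps_deriv (G oo F)"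
    unfolding E_def by (subst fps_compose_deriv) (auto simp: G0)
  also have "fps_deriv (G oo F) = (fps_deriv G oo F) * fps_deriv F"
    by (rule fps_compose_deriv[OF F0])
  finally have dE: "fps_deriv E = E * ((fps_deriv G oo F) * fps_deriv F)" .
  have "fps_deriv (E * F) = 1" by (simp add: EF)
  then have "E * (fps_deriv F * (1 + (fps_deriv G oo F) * F)) = 1"
    by (simp add: dE algebra_simps)
  then have "(E * F) * (fps_deriv F * (1 + (fps_deriv G oo F) * F)) = F"
    by (metis mult.assoc mult.commute mult.left_neutral)
  then show ?thesis by (simp add: EF mult.assoc)
qed

lemma log_inverse_fps_coeffs:
  fixes F G :: "complex fps"
  assumes eq: "fps_X * fps_deriv F * (1 + (fps_deriv G oo F) * F) = F"
    and F0: "fps_nth F 0 = 0" and F1: "fps_nth F 1 = 1"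
  shows "fps_nth G 1 = - fps_nth F 2"
    and "fps_nth G 2 = - fps_nth F 3 + 3/2 * (fps_nth F 2)\<^sup>2"
    and "fps_nth G 3 = - (fps_nth F 4 - 4 * fps_nth F 2 * fps_nth F 3 + 10/3 * (fps_nth F 2) ^ 3)"
proof -
  define P where "P = fps_deriv G oo F"
  have F1': "fps_nth F (Suc 0) = 1" using F1 by simp
  have P: "fps_nth P 0 = fps_nth G 1" "fps_nth P (Suc 0) = 2 * fps_nth G 2"
    "fps_nth P 2 = 2 * fps_nth G 2 * fps_nth F 2 + 3 * fps_nth G 3"
    by (simp_all add: P_def fps_compose_nth F0 F1' power2_eq_square fps_mult_nth numeral_2_eq_2 numeral_3_eq_3 algebra_simps)
  have eq': "fps_X * (fps_deriv F * (1 + P * F)) = F" using eq by (simp add: P_def mult.assoc)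
  have e: "fps_nth (fps_deriv F * (1 + P * F)) n = fps_nth F (Suc n)" for n
    using arg_cong[OF eq', of "\<lambda>A. fps_nth A (Suc n)"] by simp
  have e1: "2 * fps_nth F 2 + fps_nth G 1 = fps_nth F 2"
    using e[of 1] by (simp add: fps_mult_nth F0 F1' P numeral_2_eq_2)
  show g1: "fps_nth G 1 = - fps_nth F 2" using e1 by (simp add: algebra_simps eq_neg_iff_add_eq_0)
  have e2: "3 * fps_nth F 3 + 2 * fps_nth F 2 * fps_nth G 1 + (fps_nth G 1 * fps_nth F 2 + 2 * fps_nth G 2) = fps_nth F 3"
    using e[of 2] by (simp add: fps_mult_nth F0 F1' P numeral_2_eq_2 numeral_3_eq_3 algebra_simps)
  show g2: "fps_nth G 2 = - fps_nth F 3 + 3/2 * (fps_nth F 2)\<^sup>2"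
    using e2 unfolding g1 by (simp add: power2_eq_square field_simps)
  have e3: "4 * fps_nth F 4 + 3 * fps_nth F 3 * fps_nth G 1 + 2 * fps_nth F 2 * (fps_nth G 1 * fps_nth F 2 + 2 * fps_nth G 2)
     + (fps_nth G 1 * fps_nth F 3 + 2 * fps_nth G 2 * fps_nth F 2 + fps_nth P 2) = fps_nth F 4"
    using e[of 3] by (simp add: fps_mult_nth F0 F1' P numeral_2_eq_2 numeral_3_eq_3 eval_nat_numeral algebra_simps)
  have "3 * fps_nth G 3 = 3 * (- (fps_nth F 4 - 4 * fps_nth F 2 * fps_nth F 3 + 10/3 * (fps_nth F 2) ^ 3))"
    using e3 unfolding P(3) g1 g2 by (simp add: power2_eq_square power3_eq_cube algebra_simps)
  then show "fps_nth G 3 = - (fps_nth F 4 - 4 * fps_nth F 2 * fps_nth F 3 + 10/3 * (fps_nth F 2) ^ 3)"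
    by (simp only: mult_cancel_left) simp
qed

section \<open>Coefficients of Schwarz functions\<close>

text \<open>
  One step of the Schur algorithm: compose \<open>h\<close> with the disc automorphism that takes \<open>h 0\<close> to \<open>0\<close> and
  divide by \<open>z\<close>. The equation is cleared of denominators so that it also covers the constants of
  modulus one, for which the automorphism degenerates; there \<open>k = 0\<close> works.
\<close>

lemma schur_step:
  assumes holh: "h holomorphic_on ball 0 1" and le: "\<And>z. norm z < 1 \<Longrightarrow> norm (h z) \<le> 1"
  obtains k where "k holomorphic_on ball 0 1" "\<And>z. norm z < 1 \<Longrightarrow> norm (k z) \<le> 1"
    "\<And>z. norm z < 1 \<Longrightarrow> h z * (1 + cnj (h 0) * (z * k z)) = h 0 + z * k z"
proof (cases "\<exists>z. norm z < 1 \<and> norm (h z) = 1")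
  case True
  then obtain z0 where z0: "norm z0 < 1" "norm (h z0) = 1" by blast
  have "h constant_on ball 0 1"
  proof (rule Schwarz2[OF holh, of "1 - norm z0" z0])
    show sub: "ball z0 (1 - norm z0) \<subseteq> ball 0 1"
      by (simp add: ball_subset_ball_iff)
    show "norm (h z) \<le> norm (h z0)" if "norm (z0 - z) < 1 - norm z0" for z
      using sub that le[of z] z0 by (auto simp: dist_norm subset_iff)
  qed (use z0 in simp)
  then obtain b where b: "h z = b" if "norm z < 1" for z by (auto simp: constant_on_def)
  show ?thesis by (rule that[of "\<lambda>_. 0"]) (use b in auto)
next
  case False
  then have lt: "norm (h z) < 1" if "norm z < 1" for z using le[OF that] that by force
  define c where "c = h 0"
  have c: "norm c < 1" using lt[of 0] by (simp add: c_def)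
  define u where "u = (\<lambda>z. Moebius_function 0 c (h z))"
  have holu: "u holomorphic_on ball 0 1"
    unfolding u_def using lt
    by (intro holomorphic_on_compose_gen[OF holh Moebius_function_holomorphic[OF c], unfolded o_def]) auto
  have u0: "u 0 = 0" by (simp add: u_def c_def Moebius_function_eq_zero)
  have u_lt: "norm (u z) < 1" if "norm z < 1" for z
    unfolding u_def by (intro Moebius_function_norm_lt_1 c lt that)
  obtain k where k: "k holomorphic_on ball 0 1" "\<And>z. norm z < 1 \<Longrightarrow> u z = z * k z" "deriv u 0 = k 0"
    using Schwarz3[OF holu u0] by blast
  show ?thesis
  proof (rule that[OF k(1)])
    fix z :: complex assume z: "norm z < 1"
    show "norm (k z) \<le> 1"
    proof (cases "z = 0")
      case True
      then show ?thesis using Schwarz_Lemma(2)[OF holu u0 u_lt, of 0] k(3) by simp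
    next
      case nz: False
      then show ?thesis
        using Schwarz_Lemma(1)[OF holu u0 u_lt z] k(2)[OF z] by (simp add: norm_mult)
    qed
    have "norm (cnj c * h z) < 1" using c lt[OF z] norm_mult_less[of "cnj c" 1 "h z" 1] by simp
    then have "1 - cnj c * h z \<noteq> 0" by auto
    then have "u z * (1 - cnj c * h z) = h z - c" by (simp add: u_def Moebius_function_simple)
    then show "h z * (1 + cnj (h 0) * (z * k z)) = h 0 + z * k z"
      using k(2)[OF z] by (simp add: c_def algebra_simps)
  qed
qed

lemma schur_step_fps:
  fixes h k :: "complex \<Rightarrow> complex"
  assumes H: "h has_fps_expansion H" and K: "k has_fps_expansion K"
    and eq: "\<And>z. norm z < 1 \<Longrightarrow> h z * (1 + cnj (h 0) * (z * k z)) = h 0 + z * k z"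
  shows "fps_nth H 1 = (1 - (norm (h 0))\<^sup>2) * fps_nth K 0"
    and "fps_nth H 2 = (1 - (norm (h 0))\<^sup>2) * (fps_nth K 1 - cnj (h 0) * (fps_nth K 0)\<^sup>2)"
proof -
  define c where "c = h 0"
  have H0: "fps_nth H 0 = c" using has_fps_expansion_imp_0_eq_fps_nth_0[OF H] by (simp add: c_def)
  have "(\<lambda>z. h z * (1 + cnj c * (z * k z))) has_fps_expansion H * (1 + fps_const (cnj c) * (fps_X * K))"
    by (intro fps_expansion_intros H K)
  moreover have "(\<lambda>z. c + z * k z) has_fps_expansion fps_const c + fps_X * K"
    by (intro fps_expansion_intros H K)
  moreover have "eventually (\<lambda>z. h z * (1 + cnj c * (z * k z)) = c + z * k z) (nhds 0)"
    by (rule eventually_mono[OF eventually_nhds_in_open[of "ball 0 1"]]) (auto simp: eq c_def)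
  ultimately have e: "H * (1 + fps_const (cnj c) * (fps_X * K)) = fps_const c + fps_X * K"
    by (rule has_fps_expansion_eventually_eq)
  have cc: "of_real ((norm c)\<^sup>2) = c * cnj c" by (rule complex_norm_square)
  have "fps_nth H 1 + c * cnj c * fps_nth K 0 = fps_nth K 0"
    using arg_cong[OF e, of "\<lambda>A. fps_nth A 1"] by (simp add: fps_mult_nth H0 algebra_simps)
  then show h1: "fps_nth H 1 = (1 - (norm (h 0))\<^sup>2) * fps_nth K 0"
    unfolding c_def[symmetric] of_real_diff of_real_1 cc by (simp add: algebra_simps)
  have "fps_nth H 2 + fps_nth H 1 * (cnj c * fps_nth K 0) + c * cnj c * fps_nth K 1 = fps_nth K 1"
    using arg_cong[OF e, of "\<lambda>A. fps_nth A 2"] by (simp add: fps_mult_nth H0 numeral_2_eq_2 algebra_simps)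
  then show "fps_nth H 2 = (1 - (norm (h 0))\<^sup>2) * (fps_nth K 1 - cnj (h 0) * (fps_nth K 0)\<^sup>2)"
    unfolding h1 c_def[symmetric] of_real_diff of_real_1 cc
    by (simp add: algebra_simps power2_eq_square)
qed


lemma bounded_fps_coeff_1:
  assumes holh: "h holomorphic_on ball 0 1" and le: "\<And>z. norm z < 1 \<Longrightarrow> norm (h z) \<le> 1"
    and H: "h has_fps_expansion H"
  shows "norm (fps_nth H 1) \<le> 1 - (norm (fps_nth H 0))\<^sup>2"
proof -
  obtain k where k: "k holomorphic_on ball 0 1" "\<And>z. norm z < 1 \<Longrightarrow> norm (k z) \<le> 1"
    "\<And>z. norm z < 1 \<Longrightarrow> h z * (1 + cnj (h 0) * (z * k z)) = h 0 + z * k z"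
    using schur_step[OF holh le] by blast
  have K: "k has_fps_expansion fps_expansion k 0"
    using k(1) by (intro has_fps_expansion_fps_expansion) auto
  have H0: "h 0 = fps_nth H 0" and K0: "k 0 = fps_nth (fps_expansion k 0) 0"
    using has_fps_expansion_imp_0_eq_fps_nth_0 H K by auto
  have "norm (h 0) \<le> 1" "norm (k 0) \<le> 1" using le[of 0] k(2)[of 0] by auto
  then have "\<bar>1 - (norm (h 0))\<^sup>2\<bar> * norm (k 0) \<le> 1 - (norm (h 0))\<^sup>2"
    by (simp add: power_le_one mult_left_le)
  then show ?thesis
    using schur_step_fps(1)[OF H K k(3)] by (simp add: norm_mult H0 K0 del: of_real_diff)
qed

text \<open>
  The Schur parameters \<open>c\<close>, \<open>x\<close>, \<open>y\<close> of \<open>\<omega>(z) / z\<close>: two Schur steps turn the constraint \<open>\<bar>\<omega>\<bar> < 1\<close> into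
  bounds on the moduli of parameters from which the first three coefficients are computed.
\<close>

lemma schwarz_function_fps_coeffs:
  fixes \<omega> :: "complex \<Rightarrow> complex"
  assumes "schwarz_function \<omega>" and W: "\<omega> has_fps_expansion W"
  obtains c x y :: complex where "norm c \<le> 1" "norm x \<le> 1" "norm y \<le> 1 - (norm x)\<^sup>2"
    "fps_nth W 1 = c" "fps_nth W 2 = (1 - (norm c)\<^sup>2) * x"
    "fps_nth W 3 = (1 - (norm c)\<^sup>2) * (y - cnj c * x\<^sup>2)"
proof -
  have hol: "\<omega> holomorphic_on ball 0 1" and w0: "\<omega> 0 = 0"
    and lt: "\<And>z. norm z < 1 \<Longrightarrow> norm (\<omega> z) < 1"
    using assms(1) by (auto simp: schwarz_function_def)
  obtain h where h: "h holomorphic_on ball 0 1" "\<And>z. norm z < 1 \<Longrightarrow> \<omega> z = z * h z" "deriv \<omega> 0 = h 0"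
    using Schwarz3[OF hol w0] by blast
  have hle: "norm (h z) \<le> 1" if "norm z < 1" for z
  proof (cases "z = 0")
    case True
    then show ?thesis using Schwarz_Lemma(2)[OF hol w0 lt, of 0] h(3) by simp
  next
    case False
    then show ?thesis
      using Schwarz_Lemma(1)[OF hol w0 lt that] h(2)[OF that] by (simp add: norm_mult)
  qed
  define H where "H = fps_expansion h 0"
  have H: "h has_fps_expansion H"
    using h(1) unfolding H_def by (intro has_fps_expansion_fps_expansion) auto
  obtain k where k: "k holomorphic_on ball 0 1" "\<And>z. norm z < 1 \<Longrightarrow> norm (k z) \<le> 1"
    "\<And>z. norm z < 1 \<Longrightarrow> h z * (1 + cnj (h 0) * (z * k z)) = h 0 + z * k z"
    using schur_step[OF h(1) hle] by blast
  define K where "K = fps_expansion k 0"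
  have K: "k has_fps_expansion K"
    using k(1) unfolding K_def by (intro has_fps_expansion_fps_expansion) auto
  have H0: "h 0 = fps_nth H 0" and K0: "k 0 = fps_nth K 0"
    using has_fps_expansion_imp_0_eq_fps_nth_0 H K by auto
  have WH: "W = fps_X * H"
  proof (rule has_fps_expansion_eventually_eq[OF W])
    show "(\<lambda>z. z * h z) has_fps_expansion fps_X * H" by (intro fps_expansion_intros H)
    show "\<forall>\<^sub>F z in nhds 0. \<omega> z = z * h z"
      by (rule eventually_mono[OF eventually_nhds_in_open[of "ball 0 1"]]) (auto simp: h(2))
  qed
  show ?thesis
  proof (rule that[of "h 0" "k 0" "fps_nth K 1"])
    show "norm (h 0) \<le> 1" "norm (k 0) \<le> 1" using hle[of 0] k(2)[of 0] by auto
    show "norm (fps_nth K 1) \<le> 1 - (norm (k 0))\<^sup>2"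
      using bounded_fps_coeff_1[OF k(1,2) K] by (simp add: K0)
    show "fps_nth W 1 = h 0" by (simp add: WH H0)
    show "fps_nth W 2 = (1 - (norm (h 0))\<^sup>2) * k 0"
      using schur_step_fps(1)[OF H K k(3)] by (simp add: WH K0)
    show "fps_nth W 3 = (1 - (norm (h 0))\<^sup>2) * (fps_nth K 1 - cnj (h 0) * (k 0)\<^sup>2)"
      using schur_step_fps(2)[OF H K k(3)] by (simp add: WH K0)
  qed
qed

section \<open>The cubic coefficient inequality\<close>

text \<open>
  For fixed \<open>\<bar>c\<bar>\<close> and \<open>\<bar>x\<bar>\<close> the left-hand side depends on the arguments of \<open>c\<close> and \<open>x\<close> only through
  the real number \<open>B\<close>, and for \<open>\<nu> > 0\<close> and \<open>\<bar>c\<bar> < 1\<close> it is a quadratic polynomial in \<open>B\<close> with negative leading coefficient.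
  Completing the square exhibits its maximum: dropping the last term bounds the modulus uniformly
  in both arguments.
\<close>

lemma cubic_coeff_identity:
  fixes c x :: complex and \<nu> P :: real
  defines "q \<equiv> (norm c)\<^sup>2" and "\<tau> \<equiv> (norm x)\<^sup>2" and "B \<equiv> Re (c\<^sup>2 * cnj x)"
  defines "s \<equiv> 1 - q"
  shows "4 * \<nu> * (norm (of_real \<nu> * c ^ 3 - of_real (P * s) * c * x - of_real s * cnj c * x\<^sup>2))\<^sup>2
    = (\<nu> * q + s * \<tau>)\<^sup>2 * (4 * \<nu> * q + P\<^sup>2 * s) - s * (4 * \<nu> * B - P * (s * \<tau> - \<nu> * q))\<^sup>2"
proof -
  obtain a b where c: "c = Complex a b" by (cases c)
  obtain u v where x: "x = Complex u v" by (cases x)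
  have q: "q = a\<^sup>2 + b\<^sup>2" and t: "\<tau> = u\<^sup>2 + v\<^sup>2" and B: "B = (a\<^sup>2 - b\<^sup>2) * u + 2 * a * b * v"
    by (simp_all add: q_def \<tau>_def B_def c x cmod_power2) (simp add: power2_eq_square)
  have "(norm (of_real \<nu> * c ^ 3 - of_real (P * s) * c * x - of_real s * cnj c * x\<^sup>2))\<^sup>2
    = (\<nu> * (a ^ 3 - 3 * a * b\<^sup>2) - P * s * (a * u - b * v) - s * (a * (u\<^sup>2 - v\<^sup>2) + 2 * b * u * v))\<^sup>2
    + (\<nu> * (3 * a\<^sup>2 * b - b ^ 3) - P * s * (a * v + b * u) - s * (2 * a * u * v - b * (u\<^sup>2 - v\<^sup>2)))\<^sup>2"
    unfolding cmod_power2 c x by (simp add: power2_eq_square power3_eq_cube algebra_simps)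
  then show ?thesis
    unfolding B t s_def q by algebra
qed

text \<open>
  The sharp estimate behind the third coefficient. By the completed square, the part without \<open>y\<close> has
  modulus at most \<open>(35/12 q + s \<tau>) sqrt (1 + 109/420 s)\<close>, where \<open>q = 1 - s = \<bar>c\<bar>\<^sup>2\<close> and \<open>\<tau> = \<bar>x\<bar>\<^sup>2\<close>, and the
  part with \<open>y\<close> at most \<open>s (1 - \<tau>)\<close>. With the root replaced by \<open>1 + 109/840 s\<close> the sum increases
  with \<open>\<tau>\<close>, and at \<open>\<tau> = 1\<close> it is at most \<open>35/12\<close>, the value at \<open>s = 0\<close>, i.e. at \<open>\<bar>c\<bar> = 1\<close>.
\<close>

lemma cubic_coeff_bound:
  fixes c x y :: complex
  assumes c: "norm c \<le> 1" and x: "norm x \<le> 1" and y: "norm y \<le> 1 - (norm x)\<^sup>2"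
  defines "s \<equiv> 1 - (norm c)\<^sup>2"
  shows "norm (s * (y - cnj c * x\<^sup>2) - 23/6 * c * (s * x) + 35/12 * c ^ 3) \<le> 35/12"
proof -
  define q \<tau> where "q = (norm c)\<^sup>2" and "\<tau> = (norm x)\<^sup>2"
  define Z where "Z = of_real (35/12) * c ^ 3 - of_real (23/6 * s) * c * x - of_real s * cnj c * x\<^sup>2"
  have q: "0 \<le> q" "q \<le> 1" and \<tau>: "0 \<le> \<tau>" "\<tau> \<le> 1"
    using c x by (auto simp: q_def \<tau>_def power_le_one)
  have s: "s = 1 - q" by (simp add: s_def q_def)
  have s01: "0 \<le> s" "s \<le> 1" using q by (auto simp: s)
  have cancel: "a \<le> t * u" if "4 * (35/12) * a \<le> t * (4 * (35/12) * u)" for a t u :: real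
    using that by simp
  have base: "0 \<le> 35/12 * q + s * \<tau>" using q s01 \<tau> by simp
  have "4 * (35/12) * (norm Z)\<^sup>2 \<le> (35/12 * q + s * \<tau>)\<^sup>2 * (4 * (35/12) * q + (23/6)\<^sup>2 * s)"
    using cubic_coeff_identity[of "35/12" c "23/6" x] s01
    unfolding Z_def s_def q_def \<tau>_def by simp
  \<comment> \<open>\<open>(23/6)\<^sup>2 / (4 * 35/12) = 529/420 = 1 + 109/420\<close>, and \<open>q = 1 - s\<close>.\<close>
  also have "4 * (35/12) * q + (23/6)\<^sup>2 * s = 4 * (35/12) * (1 + 109/420 * s)"
    by (simp add: s power2_eq_square field_simps)
  finally have "(norm Z)\<^sup>2 \<le> (35/12 * q + s * \<tau>)\<^sup>2 * (1 + 109/420 * s)"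
    using cancel by blast
  also have "\<dots> \<le> (35/12 * q + s * \<tau>)\<^sup>2 * (1 + 109/840 * s)\<^sup>2"
  proof (rule mult_left_mono)
    show "1 + 109/420 * s \<le> (1 + 109/840 * s)\<^sup>2"
      by (simp add: power2_eq_square algebra_simps)
  qed simp
  finally have "(norm Z)\<^sup>2 \<le> ((35/12 * q + s * \<tau>) * (1 + 109/840 * s))\<^sup>2"
    by (simp add: power_mult_distrib)
  then have Z: "norm Z \<le> (35/12 * q + s * \<tau>) * (1 + 109/840 * s)"
    by (rule power2_le_imp_le) (use base s01 in simp)
  have "norm (s * y) \<le> s * (1 - \<tau>)"
    using y s01 by (simp add: norm_mult \<tau>_def mult_left_mono)
  moreover have "s * (y - cnj c * x\<^sup>2) - 23/6 * c * (s * x) + 35/12 * c ^ 3 = s * y + Z"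
    by (simp add: Z_def algebra_simps)
  ultimately have "norm (s * (y - cnj c * x\<^sup>2) - 23/6 * c * (s * x) + 35/12 * c ^ 3)
      \<le> s * (1 - \<tau>) + (35/12 * q + s * \<tau>) * (1 + 109/840 * s)"
    using norm_triangle_ineq[of "s * y" Z] Z by simp
  also have "\<dots> = s + 35/12 * q * (1 + 109/840 * s) + 109/840 * s\<^sup>2 * \<tau>"
    by (simp add: power2_eq_square algebra_simps)
  also have "\<dots> \<le> s + 35/12 * q * (1 + 109/840 * s) + 109/840 * s\<^sup>2 * 1"
    using \<tau> by (intro add_left_mono mult_left_mono) auto
  also have "\<dots> \<le> 35/12"
  proof -
    have "s * s \<ge> 0" "s * (1 - s) \<ge> 0" using s01 by auto
    moreover have "q * (1 + 109/840 * s) = 1 + 109/840 * s - s - 109/840 * (s * s)"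
      by (simp add: s field_simps)
    ultimately show ?thesis using s01 unfolding power2_eq_square mult.assoc by linarith
  qed
  finally show ?thesis .
qed

section \<open>The coefficient bounds\<close>

lemma norm_exp_mult_1_plus_sin_ge:
  fixes w :: complex
  assumes "norm w \<le> 1"
  shows "(1 - norm w) * exp (- norm w) \<le> norm (exp w * (1 + sin w))"
proof -
  have "1 - norm w \<le> Re (1 + sin w)" using Re_sin_ge_neg_norm[OF assms] by simp
  also have "\<dots> \<le> norm (1 + sin w)" by (rule complex_Re_le_cmod)
  finally have 1: "1 - norm w \<le> norm (1 + sin w)" .
  have 2: "exp (- norm w) \<le> norm (exp w)"
    using abs_Re_le_cmod[of w] by (simp add: norm_exp_eq_Re)
  show ?thesis
    using mult_mono[OF 1 2] by (simp add: norm_mult mult.commute)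
qed

text \<open>
  By the Schwarz lemma \<open>\<bar>\<omega> z\<bar> \<le> \<bar>z\<bar> = r\<close>, so \<open>\<bar>f' z\<bar> \<ge> (1 - r) e\<^sup>-\<^sup>r\<close>, the derivative of \<open>r e\<^sup>-\<^sup>r\<close>. At
  \<open>r = 1/2\<close> the latter already exceeds \<open>1/4\<close>; letting \<open>r\<close> tend to 1 would give the radius \<open>1/e\<close>.
\<close>

lemma P_star_covering:
  assumes "f \<in> P_star"
  shows "ball 0 (1/4) \<subseteq> f ` ball 0 1"
proof -
  have f: "f holomorphic_on ball 0 1" "inj_on f (ball 0 1)" "f 0 = 0"
    using assms by (auto simp: P_star_def class_S_def)
  obtain \<omega> where w: "schwarz_function \<omega>"
    and df: "\<And>z. norm z < 1 \<Longrightarrow> deriv f z = exp (\<omega> z) * (1 + sin (\<omega> z))"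
    using assms by (auto simp: P_star_def subordinate_def)
  have "ball 0 ((1/2) * exp (- (1/2))) \<subseteq> f ` ball 0 1"
  proof (rule univalent_covering[OF f, where \<psi> = "\<lambda>r. r * exp (- r)" and \<psi>' = "\<lambda>r. (1 - r) * exp (- r)" and R = "1/2"])
    show "((\<lambda>r::real. r * exp (- r)) has_real_derivative (1 - r) * exp (- r)) (at r)" for r
      by (auto intro!: derivative_eq_intros simp: algebra_simps)
    fix z :: complex assume z: "norm z < 1"
    have wz: "norm (\<omega> z) \<le> norm z"
      using w z Schwarz_Lemma(1)[of \<omega> z] by (auto simp: schwarz_function_def)
    have "(1 - norm z) * exp (- norm z) \<le> (1 - norm (\<omega> z)) * exp (- norm (\<omega> z))"
      using wz z by (intro mult_mono) auto
    also have "\<dots> \<le> norm (deriv f z)"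
      unfolding df[OF z] using wz z by (intro norm_exp_mult_1_plus_sin_ge) simp
    finally show "(1 - norm z) * exp (- norm z) \<le> norm (deriv f z)" .
  qed auto
  moreover have "exp (- (1/2)) \<ge> (1/2 :: real)" using exp_ge_add_one_self[of "-(1/2) :: real"] by simp
  then have "ball 0 (1/4) \<subseteq> ball (0::complex) ((1/2) * exp (- (1/2)))" by (intro subset_ball) simp
  ultimately show ?thesis by (meson order_trans)
qed

lemma P_star_log_inverse_coeffs:
  assumes f: "f \<in> P_star" and w: "schwarz_function \<omega>"
    and df: "\<And>z. norm z < 1 \<Longrightarrow> deriv f z = exp (\<omega> z) * (1 + sin (\<omega> z))"
    and W: "\<omega> has_fps_expansion W"
  shows "log_inverse_coeff f 1 = - fps_nth W 1 / 2"
    and "log_inverse_coeff f 2 = - fps_nth W 2 / 3 + (fps_nth W 1)\<^sup>2 / 2"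
    and "log_inverse_coeff f 3 =
      - (fps_nth W 3 - 23/6 * fps_nth W 1 * fps_nth W 2 + 35/12 * fps_nth W 1 ^ 3) / 4"
proof -
  have S: "f \<in> class_S" using f by (simp add: P_star_def)
  then have hol: "f holomorphic_on ball 0 1" and f0: "f 0 = 0" and df0: "deriv f 0 = 1"
    by (auto simp: class_S_def)
  define F where "F = fps_expansion f 0"
  have F: "f has_fps_expansion F"
    unfolding F_def using hol by (intro has_fps_expansion_fps_expansion) auto
  have F0: "fps_nth F 0 = 0" using has_fps_expansion_imp_0_eq_fps_nth_0[OF F] f0 by simp
  have F1: "fps_nth F 1 = 1" using fps_nth_fps_expansion[OF F, of 1] df0 by simp
  have W0: "fps_nth W 0 = 0"
    using has_fps_expansion_imp_0_eq_fps_nth_0[OF W] w by (simp add: schwarz_function_def)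
  obtain L where L: "log_inverse_branch f L"
    using log_inverse_branch_exists[OF S P_star_covering[OF f]] .
  define G where "G = fps_expansion L 0"
  have G: "L has_fps_expansion G"
    unfolding G_def using L
    by (intro has_fps_expansion_fps_expansion[of "ball 0 (1/4)"]) (auto simp: log_inverse_branch_def)
  \<comment> \<open>\<open>e\<^sup>z (1 + sin z) = 1 + 2 z + 3/2 z\<^sup>2 + 1/2 z\<^sup>3 + \<dots>\<close>\<close>
  define \<Phi> :: "complex fps" where "\<Phi> = fps_exp 1 * (1 + fps_sin 1)"
  have "(\<lambda>z::complex. exp z * (1 + sin z)) has_fps_expansion \<Phi>"
    unfolding \<Phi>_def by (intro fps_expansion_intros)
  then have "((\<lambda>z. exp z * (1 + sin z)) \<circ> \<omega>) has_fps_expansion (\<Phi> oo W)"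
    by (rule has_fps_expansion_compose[OF _ W W0])
  then have dF: "fps_deriv F = \<Phi> oo W"
    by (rule has_fps_expansion_eventually_eq[OF has_fps_expansion_deriv[OF F]])
      (rule eventually_mono[OF eventually_nhds_in_open[of "ball 0 1"]], auto simp: df)
  have sin: "fps_nth (fps_sin (1::complex)) 0 = 0" "fps_nth (fps_sin (1::complex)) (Suc 0) = 1"
    "fps_nth (fps_sin (1::complex)) 2 = 0" "fps_nth (fps_sin (1::complex)) 3 = - 1/6"
    by (simp_all add: fps_sin_def fact_numeral)
  have \<Phi>: "fps_nth \<Phi> 0 = 1" "fps_nth \<Phi> 1 = 2" "fps_nth \<Phi> 2 = 3/2" "fps_nth \<Phi> 3 = 1/2"
    using sin by (simp_all add: \<Phi>_def fps_mult_nth numeral_2_eq_2 numeral_3_eq_3)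
  define c1 c2 c3 where "c1 = fps_nth W 1" and "c2 = fps_nth W 2" and "c3 = fps_nth W 3"
  have n: "of_nat (Suc n) * fps_nth F (Suc n) = (\<Sum>i=0..n. fps_nth \<Phi> i * fps_nth (W ^ i) n)" for n
    using arg_cong[OF dF, of "\<lambda>A. fps_nth A n"] by (simp add: fps_compose_nth)
  have "2 * fps_nth F 2 = 2 * c1"
    using n[of 1] \<Phi> by (simp add: c1_def numeral_2_eq_2 W0)
  then have F2: "fps_nth F 2 = c1" by simp
  have "3 * fps_nth F 3 = 2 * c2 + 3/2 * c1\<^sup>2"
    using n[of 2] \<Phi> by (simp add: c1_def c2_def numeral_2_eq_2 numeral_3_eq_3 power2_eq_square fps_mult_nth W0)
  then have F3: "fps_nth F 3 = 2/3 * c2 + 1/2 * c1\<^sup>2" by (simp add: field_simps)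
  have "4 * fps_nth F 4 = fps_nth \<Phi> 1 * c3 + fps_nth \<Phi> 2 * (2 * c1 * c2) + fps_nth \<Phi> 3 * c1 ^ 3"
    using n[of 3]
    by (simp add: c1_def c2_def c3_def eval_nat_numeral fps_mult_nth W0 algebra_simps)
  then have F4: "fps_nth F 4 = 1/2 * c3 + 3/4 * c1 * c2 + 1/8 * c1 ^ 3"
    unfolding \<Phi> by (simp add: field_simps)
  note coeffs = log_inverse_fps_coeffs[OF log_inverse_fps_eq[OF S F L G] F0 F1]
  show "log_inverse_coeff f 1 = - fps_nth W 1 / 2"
    unfolding log_inverse_coeff_eq[OF L G] coeffs F2 c1_def ..
  show "log_inverse_coeff f 2 = - fps_nth W 2 / 3 + (fps_nth W 1)\<^sup>2 / 2"
    unfolding log_inverse_coeff_eq[OF L G] coeffs F2 F3 c1_def[symmetric] c2_def[symmetric]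
    by (simp add: field_simps)
  show "log_inverse_coeff f 3 =
      - (fps_nth W 3 - 23/6 * fps_nth W 1 * fps_nth W 2 + 35/12 * fps_nth W 1 ^ 3) / 4"
    unfolding log_inverse_coeff_eq[OF L G] coeffs F2 F3 F4
      c1_def[symmetric] c2_def[symmetric] c3_def[symmetric]
    by (simp add: power2_eq_square power3_eq_cube field_simps)
qed

lemma P_star_log_inverse_coeff_bounds:
  assumes f: "f \<in> P_star"
  shows "norm (log_inverse_coeff f 1) \<le> 1/2"
    and "norm (log_inverse_coeff f 2) \<le> 1/2"
    and "norm (log_inverse_coeff f 3) \<le> 35/48"
proof -
  obtain \<omega> where w: "schwarz_function \<omega>"
    and df: "\<And>z. norm z < 1 \<Longrightarrow> deriv f z = exp (\<omega> z) * (1 + sin (\<omega> z))"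
    using f by (auto simp: P_star_def subordinate_def)
  define W where "W = fps_expansion \<omega> 0"
  have W: "\<omega> has_fps_expansion W"
    unfolding W_def using w
    by (intro has_fps_expansion_fps_expansion[of "ball 0 1"]) (auto simp: schwarz_function_def)
  obtain c x y :: complex where c: "norm c \<le> 1" and x: "norm x \<le> 1" and y: "norm y \<le> 1 - (norm x)\<^sup>2"
    and W1: "fps_nth W 1 = c" and W2: "fps_nth W 2 = (1 - (norm c)\<^sup>2) * x"
    and W3: "fps_nth W 3 = (1 - (norm c)\<^sup>2) * (y - cnj c * x\<^sup>2)"
    using schwarz_function_fps_coeffs[OF w W] .
  have G1: "log_inverse_coeff f 1 = - c / 2"
    and G2: "log_inverse_coeff f 2 = - ((1 - (norm c)\<^sup>2) * x) / 3 + c\<^sup>2 / 2"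
    and G3: "log_inverse_coeff f 3 = - ((1 - (norm c)\<^sup>2) * (y - cnj c * x\<^sup>2)
        - 23/6 * c * ((1 - (norm c)\<^sup>2) * x) + 35/12 * c ^ 3) / 4"
    using P_star_log_inverse_coeffs[OF f w df W] unfolding W1 W2 W3 by auto
  have q: "(norm c)\<^sup>2 \<le> 1" using c by (simp add: power_le_one)
  show "norm (log_inverse_coeff f 1) \<le> 1/2" unfolding G1 using c by (simp add: norm_divide)
  have "norm (log_inverse_coeff f 2) \<le> norm ((1 - (norm c)\<^sup>2) * x / 3) + norm (c\<^sup>2 / 2)"
    unfolding G2 by (rule order_trans[OF norm_triangle_ineq]) (simp add: norm_divide)
  also have "\<dots> = (1 - (norm c)\<^sup>2) * norm x / 3 + (norm c)\<^sup>2 / 2"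
    using q by (simp only: norm_divide norm_mult norm_of_real norm_power) simp
  also have "\<dots> \<le> (1 - (norm c)\<^sup>2) * 1 / 3 + (norm c)\<^sup>2 / 2"
    using q x by (intro add_right_mono divide_right_mono mult_left_mono) auto
  also have "\<dots> \<le> 1/2" using q by (simp add: field_simps)
  finally show "norm (log_inverse_coeff f 2) \<le> 1/2" .
  show "norm (log_inverse_coeff f 3) \<le> 35/48"
    unfolding G3 norm_divide norm_minus_cancel using cubic_coeff_bound[OF c x y] by simp
qed

section \<open>The extremal function\<close>

text \<open>
  The antiderivative of \<open>e\<^sup>z (1 + sin z)\<close> that vanishes at the origin, i.e. the member of the class
  with \<open>\<omega>(z) = z\<close>. It attains all three bounds, since each of them is attained when the first coefficient
  of \<open>\<omega>\<close> has modulus one.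
\<close>

definition extremal :: "complex \<Rightarrow> complex" where
  "extremal z = exp z * (1 + (sin z - cos z) / 2) - 1/2"

lemma extremal_has_field_derivative:
  "(extremal has_field_derivative exp z * (1 + sin z)) (at z within A)"
  unfolding extremal_def [abs_def]
  by (auto intro!: derivative_eq_intros simp: field_simps)

lemma deriv_extremal: "deriv extremal z = exp z * (1 + sin z)"
  by (rule DERIV_imp_deriv[OF extremal_has_field_derivative])

lemma schwarz_function_id: "schwarz_function (\<lambda>z. z)"
  by (simp add: schwarz_function_def)

text \<open>
  Univalence is the only issue. The real part of \<open>e\<^sup>z (1 + sin z)\<close> itself changes sign in the disc
  (it is negative near \<open>i\<close>), so the comparison with \<open>exp\<close> is what makes the argument work.
\<close>

lemma extremal_in_P_star: "extremal \<in> P_star"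
proof -
  have hol: "extremal holomorphic_on ball 0 1"
    using extremal_has_field_derivative by (auto simp: holomorphic_on_def field_differentiable_def)
  moreover have "inj_on extremal (ball 0 1)"
  proof (rule inj_on_if_Re_deriv_div_exp_pos[OF hol])
    fix z :: complex assume "norm z < 1"
    then show "Re (deriv extremal z / exp z) > 0"
      using Re_sin_ge_neg_norm[of z] by (simp add: deriv_extremal)
  qed
  moreover have "subordinate (deriv extremal) (\<lambda>z. exp z * (1 + sin z))"
    unfolding subordinate_def deriv_extremal using schwarz_function_id by blast
  ultimately show ?thesis
    by (simp add: P_star_def class_S_def deriv_extremal) (simp add: extremal_def)
qed

lemma extremal_log_inverse_coeffs:
  "log_inverse_coeff extremal 1 = - 1/2"
  "log_inverse_coeff extremal 2 = 1/2"
  "log_inverse_coeff extremal 3 = - 35/48"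
  using P_star_log_inverse_coeffs[OF extremal_in_P_star schwarz_function_id deriv_extremal
      has_fps_expansion_fps_X]
  by simp_all

theorem theorem3p2:
  "(\<forall>f\<in>P_star.
      norm (log_inverse_coeff f 1) \<le> 1/2 \<and>
      norm (log_inverse_coeff f 2) \<le> 1/2 \<and>
      norm (log_inverse_coeff f 3) \<le> 35/48) \<and>
   (\<exists>f\<in>P_star. norm (log_inverse_coeff f 1) = 1/2) \<and>
   (\<exists>f\<in>P_star. norm (log_inverse_coeff f 2) = 1/2) \<and>
   (\<exists>f\<in>P_star. norm (log_inverse_coeff f 3) = 35/48)"
proof -
  have "norm (log_inverse_coeff extremal 1) = 1/2" "norm (log_inverse_coeff extremal 2) = 1/2"
    "norm (log_inverse_coeff extremal 3) = 35/48"
    unfolding extremal_log_inverse_coeffs by (simp_all add: norm_divide)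
  then show ?thesis using P_star_log_inverse_coeff_bounds extremal_in_P_star by blast
qed

end
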